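(* Let $(R,\mathfrak{m},K)$ be a local Artinian commutative ring, let $n\ge 1$, and let $C\subseteq R^n$ be an $R$-code such that $C\neq 0$ and $C^\perp\neq 0$. Then $C$ is MDS if and only if $C^\perp$ is MDS.
   Context: All rings are commutative with unity. $(R,\mathfrak{m},K)$ is a local Artinian ring with maximal ideal $\mathfrak{m}$ and residue field $K=R/\mathfrak{m}$. An $R$-code of length $n$ is an $R$-submodule $C\subseteq R^n$. $\lambda(M)$ denotes the length of an $R$-module $M$. The orthogonal code is $C^\perp=\{v\in R^n : v\cdot w=0 \text{ for all } w\in C\}$, where $v\cdot w=v_1w_1+\cdots+v_nw_n$. For $C\ne 0$, $d_H(C)=\min\{w_H(v) : v\in C\setminus\{0\}\}$, where $w_H(v)=|\{i : v_i\neq 0\}|$. A nonzero code $C\subseteq R^n$ is MDS (maximum distance separable) if $d_H(C)= n-\frac{\lambda(C)}{\lambda(R)}+1$. *)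

theory Defs
  imports Complex_Main "HOL-Library.Extended_Nat" "HOL-Analysis.Finite_Cartesian_Product"
begin

lemma module_self: "module ((*) :: 'a::comm_ring_1 \<Rightarrow> 'a \<Rightarrow> 'a)"
  by unfold_locales (simp_all add: algebra_simps)

lemma module_vec: "module ((*s) :: 'a::comm_ring_1 \<Rightarrow> 'a ^ 'n \<Rightarrow> 'a ^ 'n)"
  by unfold_locales (simp_all add: vec_eq_iff algebra_simps)

text \<open>
  The ring is the whole type; its ideals are the submodules of the ring acting on itself.
\<close>

definition ring_ideal :: "'a::comm_ring_1 set \<Rightarrow> bool" where
  "ring_ideal I \<longleftrightarrow> module.subspace (*) I"

definition maximal_ideal :: "'a::comm_ring_1 set \<Rightarrow> bool" where
  "maximal_ideal I \<longleftrightarrow>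
     ring_ideal I \<and> I \<noteq> UNIV \<and> (\<forall>J. ring_ideal J \<and> I \<subseteq> J \<longrightarrow> J = I \<or> J = UNIV)"

definition local_ring :: "'a::comm_ring_1 set \<Rightarrow> bool" where
  "local_ring \<mm> \<longleftrightarrow> maximal_ideal \<mm> \<and> (\<forall>I. maximal_ideal I \<longrightarrow> I = \<mm>)"

definition artinian_ring :: "'a::comm_ring_1 itself \<Rightarrow> bool" where
  "artinian_ring _ \<longleftrightarrow>
     (\<forall>I :: nat \<Rightarrow> 'a set. (\<forall>k. ring_ideal (I k)) \<and> decseq I \<longrightarrow> (\<exists>N. \<forall>k\<ge>N. I k = I N))"

text \<open>
  The length of a submodule \<open>M\<close>: the supremum of the numbers \<open>k\<close> of steps in strictly increasing
  chains \<open>N 0 \<subset> \<dots> \<subset> N k\<close> of submodules of \<open>M\<close>.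
\<close>

definition module_length ::
  "('a::comm_ring_1 \<Rightarrow> 'b::ab_group_add \<Rightarrow> 'b) \<Rightarrow> 'b set \<Rightarrow> enat" where
  "module_length smul M =
     Sup {enat k | k. \<exists>N :: nat \<Rightarrow> 'b set.
            (\<forall>i\<le>k. module.subspace smul (N i) \<and> N i \<subseteq> M) \<and> (\<forall>i<k. N i \<subset> N (Suc i))}"

definition is_code :: "('a::comm_ring_1 ^ 'n) set \<Rightarrow> bool" where
  "is_code C \<longleftrightarrow> module.subspace (*s) C"

definition dual_code :: "('a::comm_ring_1 ^ 'n) set \<Rightarrow> ('a ^ 'n) set" where
  "dual_code C = {v. \<forall>w\<in>C. scalar_product v w = 0}"

definition hamming_weight :: "'a::zero ^ 'n \<Rightarrow> nat" where
  "hamming_weight v = card {i. v $ i \<noteq> 0}"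

text \<open>Only meaningful for \<open>C \<noteq> {0}\<close>; weights are bounded by \<open>CARD('n)\<close>, so the minimum exists.\<close>

definition min_distance :: "('a::zero ^ 'n) set \<Rightarrow> nat" where
  "min_distance C = Min (hamming_weight ` (C - {0}))"

text \<open>
  Over an Artinian ring both lengths are finite and the length of the ring is positive, so
  \<open>the_enat\<close> and the division lose nothing. The quotient is taken in \<open>real\<close>, since it need not be
  an integer.
\<close>

definition mds_code :: "('a::comm_ring_1 ^ 'n) set \<Rightarrow> bool" where
  "mds_code C \<longleftrightarrow> C \<noteq> {0} \<and>
     real (min_distance C) =
       real CARD('n)
       - real (the_enat (module_length (*s) C))
           / real (the_enat (module_length (*) (UNIV :: 'a set)))
       + 1"

end

theory Submission
  imports Defs
begin

text \<open>
  Call a set \<open>S\<close> of coordinates an information set of \<open>C\<close> if the projection of \<open>C\<close> to the free module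
  on \<open>S\<close> is bijective. Two facts give the theorem.

  First, \<open>C \<noteq> 0\<close> is MDS if and only if for some \<open>k \<le> n\<close> every \<open>k\<close>-element set of coordinates is
  an information set (\<open>mds_code_iff_information_sets\<close>). The minimum distance says that projections to
  \<open>k = n - d + 1\<close> coordinates are injective, and then the length \<open>k \<lambda>(R)\<close> of \<open>C\<close> makes them onto,
  because length is additive (\<open>module_length_kernel_image\<close>) and \<open>R\<close> has finite length
  (\<open>local_artinian_length_finite\<close>).

  Second, \<open>S\<close> is an information set of \<open>C\<close> if and only if its complement is an information set of the
  dual code (\<open>information_set_dual_iff\<close>). From \<open>C\<close> to its dual this is the usual passage from a
  generator matrix \<open>(1 | A)\<close> to a parity-check matrix. The other direction cannot go through the
  double dual, which may be larger than \<open>C\<close>. Instead, if the dual code contains no nonzero word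
  supported in \<open>S\<close>, then \<open>C\<close> projects onto the free module on \<open>S\<close>
  (\<open>interpolates_if_dual_determined\<close>): a proper submodule of a free module over a local Artinian ring
  is annihilated by a nonzero functional, obtained from one that sends it into the maximal ideal by
  multiplying with a nonzero socle element.
\<close>

section \<open>Length of modules\<close>

lemma enat_leI:
  assumes "\<And>k. enat k \<le> x \<Longrightarrow> enat k \<le> y"
  shows "x \<le> y"
  using assms[of "Suc (the_enat y)"] assms[of "the_enat x"] by (cases x; cases y) auto

text \<open>
  Building chains from the top downwards makes lengths accessible to induction on the number of
  steps.
\<close>

primrec (in module) length_ge :: "nat \<Rightarrow> 'b set \<Rightarrow> bool" where
  "length_ge 0 M \<longleftrightarrow> True"
| "length_ge (Suc k) M \<longleftrightarrow> (\<exists>M'. subspace M' \<and> M' \<subset> M \<and> length_ge k M')"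

context module
begin

lemma length_ge_SucI:
  "subspace M' \<Longrightarrow> M' \<subset> M \<Longrightarrow> length_ge k M' \<Longrightarrow> length_ge (Suc k) M"
  by auto

lemma length_ge_mono: "length_ge k A \<Longrightarrow> A \<subseteq> B \<Longrightarrow> length_ge k B"
  by (cases k) (simp, metis length_ge.simps(2) psubset_subset_trans)

lemma length_ge_SucD: "length_ge (Suc k) M \<Longrightarrow> length_ge k M"
  using length_ge_mono by (metis length_ge.simps(2) psubset_imp_subset)

lemma length_ge_antimono:
  assumes "j \<le> k" "length_ge k M"
  shows "length_ge j M"
  using assms by (induction k rule: dec_induct) (blast dest: length_ge_SucD)+

lemma length_ge_iff_chain:
  assumes "subspace M"
  shows "length_ge k M \<longleftrightarrow>
    (\<exists>N :: nat \<Rightarrow> 'b set. (\<forall>i\<le>k. subspace (N i) \<and> N i \<subseteq> M) \<and> (\<forall>i<k. N i \<subset> N (Suc i)))"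
  using assms
proof (induction k arbitrary: M)
  case 0
  then show ?case by auto
next
  case (Suc k)
  show ?case
  proof
    assume "length_ge (Suc k) M"
    then obtain M' where M': "subspace M'" "M' \<subset> M" "length_ge k M'" by auto
    then obtain N where N: "\<forall>i\<le>k. subspace (N i) \<and> N i \<subseteq> M'" "\<forall>i<k. N i \<subset> N (Suc i)"
      using Suc.IH[OF M'(1)] by auto
    let ?N = "\<lambda>i. if i \<le> k then N i else M"
    have "\<forall>i\<le>Suc k. subspace (?N i) \<and> ?N i \<subseteq> M"
      using N(1) M'(2) Suc.prems by (simp, blast)
    moreover have "\<forall>i<Suc k. ?N i \<subset> ?N (Suc i)"
    proof (intro allI impI)
      fix i assume "i < Suc k"
      then show "?N i \<subset> ?N (Suc i)"
        using N M'(2) subset_psubset_trans[of "N k" M' M] by (cases "i = k") simp_all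
    qed
    ultimately show "\<exists>N :: nat \<Rightarrow> 'b set. (\<forall>i\<le>Suc k. subspace (N i) \<and> N i \<subseteq> M) \<and> (\<forall>i<Suc k. N i \<subset> N (Suc i))"
      by (intro exI[of _ ?N] conjI)
  next
    assume "\<exists>N :: nat \<Rightarrow> 'b set. (\<forall>i\<le>Suc k. subspace (N i) \<and> N i \<subseteq> M) \<and> (\<forall>i<Suc k. N i \<subset> N (Suc i))"
    then obtain N :: "nat \<Rightarrow> 'b set"
      where N: "\<forall>i\<le>Suc k. subspace (N i) \<and> N i \<subseteq> M" "\<forall>i<Suc k. N i \<subset> N (Suc i)" by (elim exE conjE)
    have le: "N i \<subseteq> N k" if "i \<le> k" for i
      using that
    proof (induction rule: inc_induct)
      case (step j)
      then show ?case using N(2)[rule_format, of j] by simp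
    qed simp
    have sub: "subspace (N k)" using N(1) by simp
    have "\<forall>i\<le>k. subspace (N i) \<and> N i \<subseteq> N k" "\<forall>i<k. N i \<subset> N (Suc i)"
      using N le by simp_all
    then have "length_ge k (N k)"
      unfolding Suc.IH[OF sub] by (intro exI[of _ N] conjI)
    moreover have "N k \<subset> M"
      using N(2)[rule_format, of k] N(1)[rule_format, of "Suc k"] by auto
    ultimately show "length_ge (Suc k) M" using sub length_ge_SucI by blast
  qed
qed

lemma enat_le_module_length_iff:
  assumes "subspace M"
  shows "enat k \<le> module_length scale M \<longleftrightarrow> length_ge k M"
proof -
  have eq: "module_length scale M = Sup {enat j | j. length_ge j M}"
    using length_ge_iff_chain[OF assms] by (simp add: module_length_def)
  show ?thesis
  proof
    assume "length_ge k M"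
    then show "enat k \<le> module_length scale M"
      unfolding eq by (auto intro: Sup_upper)
  next
    assume le: "enat k \<le> module_length scale M"
    show "length_ge k M"
    proof (cases k)
      case (Suc m)
      have "enat m < Sup {enat j | j. length_ge j M}"
        using le unfolding eq Suc Suc_ile_eq .
      then obtain j where "m < j" "length_ge j M"
        by (auto simp: less_Sup_iff)
      then show ?thesis using Suc length_ge_antimono[of k j] by auto
    qed auto
  qed
qed

lemma module_length_mono:
  assumes "subspace A" "subspace B" "A \<subseteq> B"
  shows "module_length scale A \<le> module_length scale B"
proof (rule enat_leI)
  fix k assume "enat k \<le> module_length scale A"
  then have "length_ge k A" unfolding enat_le_module_length_iff[OF assms(1)] .
  then have "length_ge k B" by (rule length_ge_mono[OF _ assms(3)])
  then show "enat k \<le> module_length scale B" unfolding enat_le_module_length_iff[OF assms(2)] .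
qed

lemma module_length_strict_mono:
  assumes "subspace A" "subspace B" "A \<subset> B" "module_length scale A \<noteq> \<infinity>"
  shows "module_length scale A < module_length scale B"
proof -
  obtain k where k: "module_length scale A = enat k" using assms(4) by auto
  then have "length_ge k A" using enat_le_module_length_iff[OF assms(1)] by (metis order_refl)
  then have "length_ge (Suc k) B" using assms length_ge_SucI by blast
  then have "enat (Suc k) \<le> module_length scale B" using enat_le_module_length_iff[OF assms(2)] by simp
  then show ?thesis using k by (simp add: Suc_ile_eq)
qed

lemma module_length_zero [simp]: "module_length scale {0} = 0"
proof -
  have "\<not> length_ge (Suc 0) {0}"
    using subspace_0 by fastforce
  then have "\<not> enat (Suc 0) \<le> module_length scale {0}"
    using enat_le_module_length_iff[of "{0}"] by auto
  then show ?thesis by (metis Suc_ile_eq zero_enat_def i0_lb not_le order_antisym)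
qed

text \<open>
  The hypothesis \<open>max\<close> says that \<open>N\<close> is all of \<open>I\<close> or a maximal proper submodule of it.
  In a strict chain below \<open>I\<close>, intersecting with \<open>N\<close> can collapse only one step: a submodule of \<open>I\<close>
  outside \<open>N\<close> already spans \<open>I\<close> together with \<open>N\<close>, and by the modular law, two nested submodules
  with equal intersections with \<open>N\<close> and equal sums with \<open>N\<close> coincide.
\<close>

lemma length_ge_maximal_subspace:
  assumes N: "subspace N" "N \<subseteq> I"
    and max: "\<And>c. c \<in> I \<Longrightarrow> c \<notin> N \<Longrightarrow> (\<forall>x\<in>I. \<exists>r. x - scale r c \<in> N)"
    and M: "subspace M" "M \<subseteq> I" "length_ge (Suc k) M"
  shows "length_ge k (M \<inter> N)"
  using M
proof (induction k arbitrary: M)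
  case (Suc k)
  then obtain M' where M': "subspace M'" "M' \<subset> M" "length_ge (Suc k) M'" by auto
  have IH: "length_ge k (M' \<inter> N)" using Suc.IH M' Suc.prems by blast
  show ?case
  proof (cases "M' \<subseteq> N")
    case True
    then have "M' \<subseteq> M \<inter> N" using M' by auto
    then show ?thesis using M' length_ge_mono by blast
  next
    case False
    then obtain c where c: "c \<in> M'" "c \<notin> N" by auto
    obtain x where x: "x \<in> M" "x \<notin> M'" using M' by auto
    obtain r where r: "x - scale r c \<in> N" using max[of c] c x M' Suc.prems by blast
    have "x - scale r c \<notin> M'"
      using x(2) c(1) subspace_add[OF M'(1), of "x - scale r c" "scale r c"] subspace_scale[OF M'(1)] by auto
    moreover have "x - scale r c \<in> M"
      using x c M' Suc.prems by (meson psubsetD subspace_diff subspace_scale)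
    ultimately have "M' \<inter> N \<subset> M \<inter> N" using r M' by blast
    then show ?thesis using IH N M' subspace_inter length_ge_SucI by blast
  qed
qed auto

text \<open>
  Zorn's lemma, used both for the existence of maximal ideals (\<open>b = 1\<close>) and for maximal proper
  submodules.
\<close>

lemma exists_maximal_subspace_avoiding:
  assumes "subspace A" "b \<notin> A"
  obtains M where "subspace M" "A \<subseteq> M" "b \<notin> M"
    "\<And>J. subspace J \<Longrightarrow> M \<subset> J \<Longrightarrow> b \<in> J"
proof -
  let ?F = "{M. subspace M \<and> A \<subseteq> M \<and> b \<notin> M}"
  have "\<exists>M\<in>?F. \<forall>X\<in>?F. M \<subseteq> X \<longrightarrow> X = M"
  proof (rule subset_Zorn_nonempty)
    show "?F \<noteq> {}" using assms by blast
    fix \<C> assume ne: "\<C> \<noteq> {}" and ch: "subset.chain ?F \<C>"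
    have mem: "X \<in> ?F" if "X \<in> \<C>" for X using ch that by (auto simp: subset.chain_def)
    have lin: "X \<subseteq> Y \<or> Y \<subseteq> X" if "X \<in> \<C>" "Y \<in> \<C>" for X Y
      using ch that by (auto simp: subset.chain_def)
    have "subspace (\<Union>\<C>)"
    proof (rule subspaceI)
      show "0 \<in> \<Union>\<C>" using ne mem subspace_0 by fastforce
      fix x y assume "x \<in> \<Union>\<C>" "y \<in> \<Union>\<C>"
      then obtain X Y where "x \<in> X" "X \<in> \<C>" "y \<in> Y" "Y \<in> \<C>" by blast
      moreover from this obtain Z where "Z \<in> \<C>" "x \<in> Z" "y \<in> Z" using lin by blast
      ultimately show "x + y \<in> \<Union>\<C>" using mem subspace_add by blast
    next
      fix c x assume "x \<in> \<Union>\<C>"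
      then show "scale c x \<in> \<Union>\<C>" using mem subspace_scale by blast
    qed
    then show "\<Union>\<C> \<in> ?F" using ne mem by blast
  qed
  then obtain M where M: "M \<in> ?F" "\<forall>X\<in>?F. M \<subseteq> X \<longrightarrow> X = M" by (rule bexE)
  show ?thesis
  proof (rule that)
    fix J assume "subspace J" "M \<subset> J"
    then show "b \<in> J" using M by blast
  qed (use M in auto)
qed

end

text \<open>
  Each strict step of a chain in \<open>M\<close> remains strict after intersecting with the kernel of \<open>f\<close> or
  after applying \<open>f\<close>; conversely a chain in the kernel is continued by the preimages of a chain in
  the image.
\<close>

lemma (in module_hom) module_length_kernel_image:
  assumes "m1.subspace M"
  shows "module_length s1 M = module_length s1 (M \<inter> {x. f x = 0}) + module_length s2 (f ` M)"
proof -
  let ?K = "{x. f x = 0}"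
  have K: "m1.subspace ?K" using m1.subspace_UNIV subspace_vimage[OF m2.subspace_single_0] by (simp add: vimage_def)
  have split: "\<exists>a b. a + b = k \<and> m1.length_ge a (M \<inter> ?K) \<and> m2.length_ge b (f ` M)"
    if "m1.subspace M" "m1.length_ge k M" for k M
    using that
  proof (induction k arbitrary: M)
    case (Suc k)
    then obtain M' where M': "m1.subspace M'" "M' \<subset> M" "m1.length_ge k M'" by auto
    then obtain a b where ab: "a + b = k" "m1.length_ge a (M' \<inter> ?K)" "m2.length_ge b (f ` M')"
      using Suc.IH by blast
    show ?case
    proof (cases "M' \<inter> ?K \<subset> M \<inter> ?K")
      case True
      then have "m1.length_ge (Suc a) (M \<inter> ?K)"
        using ab M' K by (intro m1.length_ge_SucI[of "M' \<inter> ?K"] m1.subspace_inter) auto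
      moreover have "m2.length_ge b (f ` M)"
        using ab M' by (elim m2.length_ge_mono) blast
      ultimately show ?thesis using ab by (metis add_Suc)
    next
      case False
      then have eq: "M \<inter> ?K \<subseteq> M'" using M' by blast
      have "f ` M' \<noteq> f ` M"
      proof
        assume im: "f ` M' = f ` M"
        obtain x where x: "x \<in> M" "x \<notin> M'" using M' by auto
        obtain y where y: "y \<in> M'" "f x = f y" using im x by blast
        have "x - y \<in> M \<inter> ?K" using x y M' Suc.prems m1.subspace_diff by (auto simp: diff)
        then have "x - y + y \<in> M'" using eq y M' m1.subspace_add by blast
        then show False using x by simp
      qed
      then have "f ` M' \<subset> f ` M" using M' by blast
      then have "m2.length_ge (Suc b) (f ` M)"
        by (rule m2.length_ge_SucI[OF subspace_image[OF M'(1)] _ ab(3)])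
      moreover have "m1.length_ge a (M \<inter> ?K)"
        using ab M' by (elim m1.length_ge_mono) blast
      ultimately show ?thesis using ab by (metis add_Suc_right)
    qed
  qed auto
  have glue: "m1.length_ge (a + b) M"
    if "m1.subspace M" "m1.length_ge a (M \<inter> ?K)" "m2.length_ge b (f ` M)" for a b M
    using that
  proof (induction b arbitrary: M)
    case 0
    then show ?case using m1.length_ge_mono by auto
  next
    case (Suc b)
    then obtain P where P: "m2.subspace P" "P \<subset> f ` M" "m2.length_ge b P" by auto
    let ?M = "M \<inter> f -` P"
    have sub: "m1.subspace ?M" by (rule m1.subspace_inter[OF Suc.prems(1) subspace_vimage[OF P(1)]])
    have im: "f ` ?M = P" using P by blast
    have ker: "?M \<inter> ?K = M \<inter> ?K" using m2.subspace_0[OF P(1)] by auto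
    have "m1.length_ge (a + b) ?M"
      using Suc.IH[of ?M] sub im ker P Suc.prems by auto
    moreover have "?M \<subset> M" using im P by blast
    ultimately show ?case using sub m1.length_ge_SucI by (metis add_Suc_right)
  qed
  have enat_le_add: "enat k \<le> x + y \<longleftrightarrow> (\<exists>a b. a + b = k \<and> enat a \<le> x \<and> enat b \<le> y)" for k x y
  proof
    assume le: "enat k \<le> x + y"
    show "\<exists>a b. a + b = k \<and> enat a \<le> x \<and> enat b \<le> y"
    proof (cases "enat k \<le> x")
      case True
      then show ?thesis by (intro exI[of _ k] exI[of _ 0]) (auto simp: zero_enat_def[symmetric])
    next
      case False
      then obtain m where "x = enat m" "m < k" by (cases x) auto
      then show ?thesis using le by (intro exI[of _ m] exI[of _ "k - m"], cases y) auto
    qed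
  next
    assume "\<exists>a b. a + b = k \<and> enat a \<le> x \<and> enat b \<le> y"
    then show "enat k \<le> x + y" by (metis add_mono plus_enat_simps(1))
  qed
  have "enat k \<le> module_length s1 M \<longleftrightarrow>
    enat k \<le> module_length s1 (M \<inter> ?K) + module_length s2 (f ` M)" for k
    unfolding enat_le_add m1.enat_le_module_length_iff[OF assms]
      m1.enat_le_module_length_iff[OF m1.subspace_inter[OF assms K]]
      m2.enat_le_module_length_iff[OF subspace_image[OF assms]]
    using split[OF assms] glue[OF assms] by blast
  note eq = this
  show ?thesis
  proof (rule antisym)
    show "module_length s1 M \<le> module_length s1 (M \<inter> ?K) + module_length s2 (f ` M)"
      using enat_leI eq by blast
    show "module_length s1 (M \<inter> ?K) + module_length s2 (f ` M) \<le> module_length s1 M"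
      using enat_leI eq by blast
  qed
qed

section \<open>Local Artinian rings\<close>

interpretation self: module "(*) :: 'a::comm_ring_1 \<Rightarrow> 'a \<Rightarrow> 'a"
  by (rule module_self)

text \<open>As a rewrite rule on the ring itself, this is reversed associativity, which loops with the usual orientation.\<close>
declare self.scale_scale [simp del]

lemma ring_ideal_principal: "ring_ideal (range ((*) (x::'a::comm_ring_1)))"
  unfolding ring_ideal_def
proof (rule self.subspaceI)
  show "0 \<in> range ((*) x)" by (rule range_eqI[of _ _ 0]) simp
  fix a b assume "a \<in> range ((*) x)" "b \<in> range ((*) x)"
  then obtain r r' where "a = x * r" "b = x * r'" by blast
  then show "a + b \<in> range ((*) x)" by (intro range_eqI[of _ _ "r + r'"]) (simp add: distrib_left)
next
  fix c a assume "a \<in> range ((*) x)"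
  then obtain r where "a = x * r" by blast
  then show "c * a \<in> range ((*) x)" by (intro range_eqI[of _ _ "c * r"]) (simp add: mult.left_commute)
qed

lemma local_ring_unit:
  fixes \<mm> :: "'a::comm_ring_1 set"
  assumes "local_ring \<mm>" "x \<notin> \<mm>"
  obtains y where "x * y = 1"
proof -
  have "1 \<in> range ((*) x)"
  proof (rule ccontr)
    assume "1 \<notin> range ((*) x)"
    then obtain M where M: "self.subspace M" "range ((*) x) \<subseteq> M" "1 \<notin> M"
      "\<And>J. self.subspace J \<Longrightarrow> M \<subset> J \<Longrightarrow> 1 \<in> J"
      using self.exists_maximal_subspace_avoiding ring_ideal_principal[of x]
      unfolding ring_ideal_def by blast
    have "J = UNIV" if "self.subspace J" "1 \<in> J" for J
      using self.subspace_scale[OF that] by auto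
    then have "maximal_ideal M"
      unfolding maximal_ideal_def ring_ideal_def using M by blast
    then have "M = \<mm>" using assms by (simp add: local_ring_def)
    moreover have "x \<in> M" using M(2) rangeI[of "(*) x" 1] by auto
    ultimately show False using assms by simp
  qed
  then show ?thesis using that by auto
qed

lemma artinian_minimal_ideal:
  fixes P :: "'a::comm_ring_1 set \<Rightarrow> bool"
  assumes art: "artinian_ring TYPE('a)" and "ring_ideal I0" "P I0"
  obtains I where "ring_ideal I" "P I" "\<And>J. ring_ideal J \<Longrightarrow> J \<subset> I \<Longrightarrow> \<not> P J"
proof -
  let ?r = "{(J, I). ring_ideal J \<and> ring_ideal (I :: 'a set) \<and> J \<subset> I}"
  have "wf ?r"
    unfolding wf_iff_no_infinite_down_chain
  proof
    assume "\<exists>f. \<forall>i. (f (Suc i), f i) \<in> ?r"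
    then obtain f where "\<forall>i. (f (Suc i), f i) \<in> ?r" ..
    then have f: "ring_ideal (f i)" "f (Suc i) \<subset> f i" for i by simp_all
    have "decseq f" by (intro decseq_SucI psubset_imp_subset f)
    then obtain N where N: "\<forall>k\<ge>N. f k = f N"
      using art f(1) unfolding artinian_ring_def by blast
    have "f (Suc N) = f N" by (rule N[rule_format]) simp
    then show False using f(2)[of N] by simp
  qed
  moreover have "I0 \<in> {I. ring_ideal I \<and> P I}" using assms by simp
  ultimately obtain I where "I \<in> {I. ring_ideal I \<and> P I}"
    "\<And>J. (J, I) \<in> ?r \<Longrightarrow> J \<notin> {I. ring_ideal I \<and> P I}" by (rule wfE_min) blast
  then show ?thesis using that by blast
qed

lemma local_ring_ideal: "local_ring \<mm> \<Longrightarrow> self.subspace \<mm>"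
  by (simp add: local_ring_def maximal_ideal_def ring_ideal_def)

lemma one_notin_local: "local_ring \<mm> \<Longrightarrow> 1 \<notin> \<mm>"
  using self.subspace_scale[of \<mm> 1] by (auto simp: local_ring_def maximal_ideal_def ring_ideal_def)

lemma local_ring_one_minus_cancel:
  assumes "local_ring \<mm>" "x \<in> \<mm>" "(1 - x) * y = 0"
  shows "y = 0"
proof -
  have "1 - x \<notin> \<mm>"
    using self.subspace_add[OF local_ring_ideal[OF assms(1)], of "1 - x" x] one_notin_local[OF assms(1)] assms(2)
    by auto
  then obtain z where "(1 - x) * z = 1" using local_ring_unit assms(1) by blast
  then have "y = (1 - x) * z * y" by simp
  also have "\<dots> = z * ((1 - x) * y)" by (simp only: ac_simps)
  finally show ?thesis using assms(3) by simp
qed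

lemma maximal_ideal_nilpotent_element:
  fixes x :: "'a::comm_ring_1"
  assumes loc: "local_ring \<mm>" and art: "artinian_ring TYPE('a)" and x: "x \<in> \<mm>"
  obtains n where "x ^ n = 0"
proof -
  have dec: "decseq (\<lambda>k. range ((*) (x ^ k)))"
  proof (rule decseq_SucI)
    fix k show "range ((*) (x ^ Suc k)) \<subseteq> range ((*) (x ^ k))"
    proof (rule image_subsetI)
      fix r show "x ^ Suc k * r \<in> range ((*) (x ^ k))"
        by (rule range_eqI[of _ _ "x * r"]) (simp only: power_Suc ac_simps)
    qed
  qed
  have "\<exists>n. \<forall>k\<ge>n. range ((*) (x ^ k)) = range ((*) (x ^ n))"
    by (rule art[unfolded artinian_ring_def, rule_format]) (simp add: dec ring_ideal_principal)
  then obtain n where n: "\<forall>k\<ge>n. range ((*) (x ^ k)) = range ((*) (x ^ n))" ..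
  have "range ((*) (x ^ Suc n)) = range ((*) (x ^ n))" by (rule n[rule_format]) simp
  then have "x ^ n \<in> range ((*) (x ^ Suc n))" using rangeI[of "(*) (x ^ n)" 1] by simp
  then obtain z where z: "x ^ n = x ^ Suc n * z" by blast
  have "(1 - x * z) * x ^ n = x ^ n - x ^ Suc n * z" by (simp add: algebra_simps)
  also have "\<dots> = 0" by (rule right_minus_eq[THEN iffD2, OF z])
  finally have "(1 - x * z) * x ^ n = 0" .
  moreover have "x * z \<in> \<mm>"
    using self.subspace_scale[OF local_ring_ideal[OF loc] x, of z] by (simp add: mult.commute)
  ultimately show ?thesis using that local_ring_one_minus_cancel[OF loc] by blast
qed

text \<open>
  A generator of a minimal nonzero ideal: if \<open>x \<in> \<mm>\<close> and \<open>x s \<noteq> 0\<close>, minimality returns \<open>s\<close> as a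
  multiple of \<open>x s\<close>, which the invertibility of elements \<open>1 - r x\<close> forbids.
\<close>

lemma exists_socle_element:
  fixes \<mm> :: "'a::comm_ring_1 set"
  assumes loc: "local_ring \<mm>" and art: "artinian_ring TYPE('a)"
  obtains s where "s \<noteq> 0" "\<And>x. x \<in> \<mm> \<Longrightarrow> x * s = 0"
proof -
  have "ring_ideal (UNIV :: 'a set)" by (simp add: ring_ideal_def)
  moreover have "(UNIV :: 'a set) \<noteq> {0}" by (metis UNIV_I singletonD zero_neq_one)
  ultimately obtain J :: "'a set" where J: "ring_ideal J" "J \<noteq> {0}"
    "\<And>J'. ring_ideal J' \<Longrightarrow> J' \<subset> J \<Longrightarrow> \<not> J' \<noteq> {0}"
    using artinian_minimal_ideal[OF art, of UNIV "\<lambda>J. J \<noteq> {0}"] by blast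
  then obtain s where s: "s \<in> J" "s \<noteq> 0"
    using self.subspace_0 unfolding ring_ideal_def by blast
  have "x * s = 0" if x: "x \<in> \<mm>" for x
  proof (rule ccontr)
    assume ne: "x * s \<noteq> 0"
    have "range ((*) (x * s)) \<subseteq> J"
    proof
      fix a assume "a \<in> range ((*) (x * s))"
      then obtain r where "a = x * s * r" by blast
      then have "a = (x * r) * s" by (simp only: ac_simps)
      then show "a \<in> J" using self.subspace_scale J(1) s(1) unfolding ring_ideal_def by blast
    qed
    moreover have "x * s \<in> range ((*) (x * s))" using rangeI[of "(*) (x * s)" 1] by simp
    ultimately have "range ((*) (x * s)) = J"
      using J(3)[OF ring_ideal_principal] ne by blast
    then obtain r where r: "s = x * s * r" using s by blast
    have "(1 - r * x) * s = s - x * s * r" by (simp add: algebra_simps)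
    also have "\<dots> = 0" by (rule right_minus_eq[THEN iffD2, OF r])
    finally have "(1 - r * x) * s = 0" .
    then show False
      using local_ring_one_minus_cancel[OF loc] self.subspace_scale[OF local_ring_ideal[OF loc] x] s by blast
  qed
  then show ?thesis using that s by blast
qed

lemma module_hom_mult: "module_hom (*) (*) ((*) (x::'a::comm_ring_1))"
  by unfold_locales (simp_all add: algebra_simps)

text \<open>
  Otherwise let \<open>I\<close> be minimal among the ideals of infinite length. For \<open>x \<in> \<mm>\<close>, additivity of length
  on \<open>x : I \<rightarrow> I\<close> and minimality give \<open>x I = I\<close> or \<open>x I = 0\<close>, hence \<open>x I = 0\<close> because \<open>x\<close> is
  nilpotent. So \<open>I\<close> is a vector space over the residue field; it has a hyperplane \<open>N\<close>, which has
  finite length, and \<open>I\<close> exceeds it in length by at most one.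
\<close>

lemma local_artinian_length_finite:
  fixes \<mm> :: "'a::comm_ring_1 set"
  assumes loc: "local_ring \<mm>" and art: "artinian_ring TYPE('a)"
  shows "module_length (*) (UNIV :: 'a set) \<noteq> \<infinity>"
proof
  assume "module_length (*) (UNIV :: 'a set) = \<infinity>"
  then obtain I :: "'a set" where I: "ring_ideal I" "module_length (*) I = \<infinity>"
    and min: "\<And>J. ring_ideal J \<Longrightarrow> J \<subset> I \<Longrightarrow> module_length (*) J \<noteq> \<infinity>"
    using artinian_minimal_ideal[OF art, of UNIV "\<lambda>J. module_length (*) J = \<infinity>"]
    by (metis self.subspace_UNIV ring_ideal_def)
  have sI: "self.subspace I" using I by (simp add: ring_ideal_def)
  have ann: "x * c = 0" if x: "x \<in> \<mm>" and c: "c \<in> I" for x c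
  proof -
    interpret mx: module_hom "(*)" "(*)" "(*) x" by (rule module_hom_mult)
    have im: "(*) x ` I \<subseteq> I" using self.subspace_scale[OF sI] by blast
    have sim: "self.subspace ((*) x ` I)" by (rule mx.subspace_image[OF sI])
    have sker: "self.subspace (I \<inter> {y. x * y = 0})"
      by (rule self.subspace_inter[OF sI]) (auto intro!: self.subspaceI simp: algebra_simps mult.left_commute)
    have len: "module_length (*) I = module_length (*) (I \<inter> {y. x * y = 0}) + module_length (*) ((*) x ` I)"
      by (rule mx.module_length_kernel_image[OF sI])
    show ?thesis
    proof (cases "(*) x ` I = I")
      case True
      obtain n where n: "x ^ n = 0" using maximal_ideal_nilpotent_element[OF loc art x] .
      have "(*) (x ^ k) ` I = I" for k
      proof (induction k)
        case (Suc k)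
        have "(*) (x ^ Suc k) ` I = (*) x ` ((*) (x ^ k) ` I)"
          by (simp add: image_image mult.assoc)
        then show ?case using Suc True by simp
      qed simp
      from this[of n] have "I \<subseteq> {0}" using n by auto
      then show ?thesis using c by auto
    next
      case False
      then have "module_length (*) ((*) x ` I) \<noteq> \<infinity>" using min im sim by (simp add: ring_ideal_def psubset_eq)
      then have "module_length (*) (I \<inter> {y. x * y = 0}) = \<infinity>"
        using len I by (metis plus_eq_infty_iff_enat)
      then have "I \<inter> {y. x * y = 0} = I"
        using min[of "I \<inter> {y. x * y = 0}"] sker by (auto simp: ring_ideal_def)
      then show ?thesis using c by blast
    qed
  qed
  have "I \<noteq> {0}" using I by auto
  then obtain b where b: "b \<in> I" "b \<noteq> 0" using self.subspace_0[OF sI] by blast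
  from b have "b \<notin> {0}" by simp
  with self.subspace_single_0 obtain M where M: "self.subspace M" "{0} \<subseteq> M" "b \<notin> M"
    "\<And>J. self.subspace J \<Longrightarrow> M \<subset> J \<Longrightarrow> b \<in> J"
    by (rule self.exists_maximal_subspace_avoiding) blast
  have max: "\<forall>x\<in>I. \<exists>r. x - r * c \<in> M \<inter> I" if c: "c \<in> I" "c \<notin> M \<inter> I" for c
  proof -
    \<comment> \<open>Maximality of \<open>M\<close> puts \<open>b\<close> into \<open>M + R c'\<close>; the coefficient of \<open>c'\<close> is a unit because \<open>\<mm>\<close> annihilates \<open>c'\<close>.\<close>
    have unit: "\<exists>u v. u * v = 1 \<and> b - u * c' \<in> M" if c': "c' \<in> I" "c' \<notin> M" for c'
    proof -
      let ?J = "{m + r * c' | m r. m \<in> M}"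
      have "self.subspace ?J"
      proof (rule self.subspaceI)
        show "0 \<in> ?J" using self.subspace_0[OF M(1)] by (auto intro!: exI[of _ 0])
        fix x y assume "x \<in> ?J" "y \<in> ?J"
        then obtain m r m' r' where "x = m + r * c'" "y = m' + r' * c'" "m \<in> M" "m' \<in> M" by blast
        then have "x + y = (m + m') + (r + r') * c'" "m + m' \<in> M"
          using self.subspace_add[OF M(1)] by (auto simp: algebra_simps)
        then show "x + y \<in> ?J" by blast
      next
        fix d x assume "x \<in> ?J"
        then obtain m r where "x = m + r * c'" "m \<in> M" by blast
        then have "d * x = d * m + (d * r) * c'" by (simp add: algebra_simps)
        moreover have "d * m \<in> M" by (rule self.subspace_scale[OF M(1) \<open>m \<in> M\<close>])
        ultimately show "d * x \<in> ?J" by blast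
      qed
      moreover have "M \<subset> ?J"
      proof -
        have "m \<in> ?J" if "m \<in> M" for m
          by (rule CollectI, rule exI[of _ m], rule exI[of _ 0]) (simp add: that)
        moreover have "c' \<in> ?J"
          by (rule CollectI, rule exI[of _ 0], rule exI[of _ 1]) (simp add: self.subspace_0[OF M(1)])
        ultimately show ?thesis using c' by blast
      qed
      ultimately have "b \<in> ?J" by (rule M(4))
      then obtain m r where r: "b = m + r * c'" "m \<in> M" by blast
      then have "r \<notin> \<mm>" using ann[of r c'] c' M(3) by auto
      then obtain v where "r * v = 1" using local_ring_unit[OF loc] by blast
      moreover have "b - r * c' \<in> M" using r by simp
      ultimately show ?thesis by blast
    qed
    obtain u v where uv: "u * v = 1" "b - u * c \<in> M" using unit[of c] c by blast
    show ?thesis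
    proof
      fix x assume x: "x \<in> I"
      show "\<exists>r. x - r * c \<in> M \<inter> I"
      proof (cases "x \<in> M")
        case True
        then show ?thesis using x by (intro exI[of _ 0]) auto
      next
        case False
        then obtain u' v' where uv': "u' * v' = 1" "b - u' * x \<in> M" using unit[of x] x by blast
        have "(b - u * c) - (b - u' * x) \<in> M" using self.subspace_diff[OF M(1)] uv uv' by blast
        then have "v' * ((b - u * c) - (b - u' * x)) \<in> M" using self.subspace_scale[OF M(1)] by blast
        moreover have "v' * ((b - u * c) - (b - u' * x)) = (u' * v') * x - (v' * u) * c"
          by (simp add: algebra_simps)
        ultimately have "x - (v' * u) * c \<in> M" using uv' by simp
        moreover have "x - (v' * u) * c \<in> I"
          using x c self.subspace_diff[OF sI] self.subspace_scale[OF sI] by blast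
        ultimately show ?thesis by blast
      qed
    qed
  qed
  have sN: "self.subspace (M \<inter> I)" using M sI self.subspace_inter by blast
  have "M \<inter> I \<subset> I" using b M by blast
  then obtain k where k: "module_length (*) (M \<inter> I) = enat k"
    using min sN by (metis ring_ideal_def not_infinity_eq)
  have "enat (Suc (Suc k)) \<le> module_length (*) I" using I by simp
  then have "self.length_ge (Suc (Suc k)) I"
    using self.enat_le_module_length_iff[OF sI] by blast
  then have "self.length_ge (Suc k) (I \<inter> (M \<inter> I))"
    by (intro self.length_ge_maximal_subspace[where I = I] sN sI max) auto
  moreover have "I \<inter> (M \<inter> I) = M \<inter> I" by blast
  ultimately have "enat (Suc k) \<le> module_length (*) (M \<inter> I)"
    using self.enat_le_module_length_iff[OF sN] by simp
  then show False using k by simp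
qed

lemma ring_length_pos: "module_length (*) (UNIV :: 'a::comm_ring_1 set) \<noteq> 0"
proof -
  have "{0} \<noteq> (UNIV :: 'a set)" by (metis UNIV_I singletonD zero_neq_one)
  then have "{0} \<subset> (UNIV :: 'a set)" by blast
  then have "module_length (*) {0 :: 'a} < module_length (*) (UNIV :: 'a set)"
    by (intro self.module_length_strict_mono) simp_all
  then show ?thesis by auto
qed

section \<open>Information sets and duality\<close>

interpretation free: module "(*s) :: 'a::comm_ring_1 \<Rightarrow> 'a ^ 'n \<Rightarrow> 'a ^ 'n"
  by (rule module_vec)

definition interpolates :: "('a::comm_ring_1 ^ 'n) set \<Rightarrow> 'n set \<Rightarrow> bool" where
  "interpolates C S \<longleftrightarrow> (\<forall>x :: 'a ^ 'n. \<exists>c\<in>C. \<forall>i\<in>S. c $ i = x $ i)"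

definition determined_by :: "('a::comm_ring_1 ^ 'n) set \<Rightarrow> 'n set \<Rightarrow> bool" where
  "determined_by C S \<longleftrightarrow> (\<forall>c\<in>C. (\<forall>i\<in>S. c $ i = 0) \<longrightarrow> c = 0)"

text \<open>
  An information set of \<open>C\<close> presents \<open>C\<close> as the graph of a linear map from the entries on \<open>S\<close> to
  the entries outside \<open>S\<close>; in particular \<open>C\<close> is free of rank \<open>card S\<close>.
\<close>

definition information_set :: "('a::comm_ring_1 ^ 'n) set \<Rightarrow> 'n set \<Rightarrow> bool" where
  "information_set C S \<longleftrightarrow> interpolates C S \<and> determined_by C S"

lemma determined_by_mono: "determined_by C T \<Longrightarrow> T \<subseteq> S \<Longrightarrow> determined_by C S"
  unfolding determined_by_def by blast

lemma dual_code_is_code: "is_code (dual_code (C :: ('a::comm_ring_1 ^ 'n) set))"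
  unfolding is_code_def
proof (rule free.subspaceI)
  show "(0 :: 'a ^ 'n) \<in> dual_code C" by (simp add: dual_code_def scalar_product_def)
  fix x y assume "x \<in> dual_code C" "y \<in> dual_code C"
  then show "x + y \<in> dual_code C"
    by (simp add: dual_code_def scalar_product_def distrib_right sum.distrib)
next
  fix r x assume "x \<in> dual_code C"
  then show "r *s x \<in> dual_code C"
    by (simp add: dual_code_def scalar_product_def mult.assoc sum_distrib_left[symmetric])
qed

lemma scalar_product_commute:
  "scalar_product v w = scalar_product w (v :: 'a::comm_ring_1 ^ 'n)"
  by (simp add: scalar_product_def mult.commute)

lemma subset_double_dual: "C \<subseteq> dual_code (dual_code C)"
  by (auto simp: dual_code_def) (metis scalar_product_commute)

text \<open>
  A dual word supported in \<open>S\<close> has its \<open>j\<close>-th entry read off by the code word that restricts to the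
  \<open>j\<close>-th unit vector on \<open>S\<close>.
\<close>

lemma dual_determined_by_complement:
  fixes C :: "('a::comm_ring_1 ^ 'n) set"
  assumes "interpolates C S"
  shows "determined_by (dual_code C) (- S)"
  unfolding determined_by_def
proof (intro ballI impI)
  fix v assume v: "v \<in> dual_code C" "\<forall>i\<in>- S. v $ i = 0"
  have "v $ j = 0" for j
  proof (cases "j \<in> S")
    case True
    obtain c where c: "c \<in> C" "\<forall>i\<in>S. c $ i = axis j 1 $ i"
      using assms unfolding interpolates_def by blast
    have "v $ i * c $ i = (if i = j then v $ i else 0)" for i
      using c(2) v(2) True by (cases "i \<in> S") (auto simp: axis_def)
    then have "scalar_product v c = v $ j" by (simp add: scalar_product_def)
    then show ?thesis using v(1) c(1) by (simp add: dual_code_def)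
  qed (use v in simp)
  then show "v = 0" by (simp add: vec_eq_iff)
qed

lemma code_determined_by_complement:
  assumes "interpolates (dual_code C) (- S)"
  shows "determined_by C S"
  using dual_determined_by_complement[OF assms] subset_double_dual[of C]
  unfolding determined_by_def by auto

text \<open>Words of \<open>C\<close> restricting to unit vectors on \<open>S\<close> serve as rows of a generator matrix.\<close>

lemma interpolates_obtain_rows:
  fixes C :: "('a::comm_ring_1 ^ 'n) set"
  assumes C: "is_code C" and S: "interpolates C S"
  obtains g :: "'n \<Rightarrow> 'a ^ 'n" where
    "\<And>c. c \<in> C \<Longrightarrow> c - (\<Sum>i\<in>S. c $ i *s g i) \<in> C"
    "\<And>c k. k \<in> S \<Longrightarrow> (c - (\<Sum>i\<in>S. c $ i *s g i)) $ k = 0"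
proof -
  have "\<forall>i. \<exists>c. c \<in> C \<and> (\<forall>k\<in>S. c $ k = axis i 1 $ k)"
    using S unfolding interpolates_def by blast
  then obtain g where g: "\<And>i. g i \<in> C" "\<And>i k. k \<in> S \<Longrightarrow> g i $ k = axis i 1 $ k" by metis
  show ?thesis
  proof
    fix c assume "c \<in> C"
    then show "c - (\<Sum>i\<in>S. c $ i *s g i) \<in> C"
      using C g(1) unfolding is_code_def
      by (intro free.subspace_diff free.subspace_sum free.subspace_scale)
  next
    fix c :: "'a ^ 'n" and k assume k: "k \<in> S"
    have "(\<Sum>i\<in>S. c $ i * g i $ k) = (\<Sum>i\<in>S. if i = k then c $ k else 0)"
      by (intro sum.cong) (auto simp: g(2)[OF k] axis_def)
    then show "(c - (\<Sum>i\<in>S. c $ i *s g i)) $ k = 0" using k by simp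
  qed
qed

text \<open>
  The parity-check vector with free entries \<open>x\<close> outside \<open>S\<close>: for a generator matrix \<open>(1 | A)\<close> with
  rows \<open>g\<close>, its entries on \<open>S\<close> are those of \<open>- A x\<close>.
\<close>

definition parity_check :: "'n set \<Rightarrow> ('n \<Rightarrow> 'a::comm_ring_1 ^ 'n) \<Rightarrow> 'a ^ 'n \<Rightarrow> 'a ^ 'n" where
  "parity_check S g x = (\<chi> i. if i \<in> S then - (\<Sum>j\<in>- S. x $ j * g i $ j) else x $ i)"

lemma scalar_product_parity_check:
  fixes c :: "'a::comm_ring_1 ^ 'n"
  shows "scalar_product (parity_check S g x) c = (\<Sum>j\<in>- S. x $ j * (c - (\<Sum>i\<in>S. c $ i *s g i)) $ j)"
proof -
  have "(\<Sum>i\<in>S. (\<Sum>j\<in>- S. x $ j * g i $ j) * c $ i) = (\<Sum>i\<in>S. \<Sum>j\<in>- S. x $ j * (c $ i * g i $ j))"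
    by (simp add: sum_distrib_left sum_distrib_right mult_ac)
  also have "\<dots> = (\<Sum>j\<in>- S. \<Sum>i\<in>S. x $ j * (c $ i * g i $ j))"
    by (rule sum.swap)
  finally have swap: "(\<Sum>i\<in>S. (\<Sum>j\<in>- S. x $ j * g i $ j) * c $ i) =
    (\<Sum>j\<in>- S. \<Sum>i\<in>S. x $ j * (c $ i * g i $ j))" .
  have "scalar_product (parity_check S g x) c =
    (\<Sum>i\<in>S. parity_check S g x $ i * c $ i) + (\<Sum>i\<in>- S. parity_check S g x $ i * c $ i)"
    unfolding scalar_product_def by (subst sum.union_disjoint[symmetric]) (auto simp: Compl_partition)
  also have "(\<Sum>i\<in>S. parity_check S g x $ i * c $ i) = - (\<Sum>i\<in>S. (\<Sum>j\<in>- S. x $ j * g i $ j) * c $ i)"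
    unfolding sum_negf[symmetric] by (intro sum.cong) (simp_all add: parity_check_def)
  also have "(\<Sum>i\<in>- S. parity_check S g x $ i * c $ i) = (\<Sum>j\<in>- S. x $ j * c $ j)"
    by (intro sum.cong) (simp_all add: parity_check_def)
  finally show ?thesis
    unfolding swap
    by (simp add: right_diff_distrib sum_subtractf sum_distrib_left)
qed

lemma dual_interpolates_complement:
  assumes C: "is_code C" and S: "information_set C S"
  shows "interpolates (dual_code C) (- S)"
  unfolding interpolates_def
proof
  fix x
  obtain g where g: "\<And>c. c \<in> C \<Longrightarrow> c - (\<Sum>i\<in>S. c $ i *s g i) \<in> C"
    "\<And>c k. k \<in> S \<Longrightarrow> (c - (\<Sum>i\<in>S. c $ i *s g i)) $ k = 0"
    using interpolates_obtain_rows[OF C] S unfolding information_set_def by metis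
  have "c - (\<Sum>i\<in>S. c $ i *s g i) = 0" if "c \<in> C" for c
    using S g that unfolding information_set_def determined_by_def by blast
  then have "parity_check S g x \<in> dual_code C"
    unfolding dual_code_def by (simp add: scalar_product_parity_check del: vector_minus_component)
  then show "\<exists>c\<in>dual_code C. \<forall>i\<in>- S. c $ i = x $ i"
    by (rule rev_bexI) (simp add: parity_check_def)
qed

text \<open>
  By induction on \<open>S\<close>. If \<open>C\<close> interpolates on \<open>S\<close>, consider the entries at a further coordinate \<open>i\<close> of
  the words vanishing on \<open>S\<close>. If one of them is a unit, \<open>C\<close> interpolates on \<open>insert i S\<close>. Otherwise
  all of them lie in \<open>\<mm>\<close>, so they are killed by a socle element \<open>s\<close>, and the parity-check vector
  with entry \<open>s\<close> at \<open>i\<close> is a nonzero dual word supported in \<open>insert i S\<close>. The socle element stands in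
  for the double-annihilator property \<open>dual_code (dual_code C) = C\<close>, which can fail if the ring is
  not Frobenius.
\<close>

lemma interpolates_if_dual_determined:
  fixes \<mm> :: "'a::comm_ring_1 set" and C :: "('a ^ 'n) set"
  assumes loc: "local_ring \<mm>" and art: "artinian_ring TYPE('a)" and C: "is_code C"
    and "determined_by (dual_code C) (- S)"
  shows "interpolates C S"
  using finite[of S] assms(4)
proof (induction S rule: finite_induct)
  case empty
  have "0 \<in> C" using C free.subspace_0 by (simp add: is_code_def)
  then show ?case by (auto simp: interpolates_def)
next
  case (insert i S)
  have IH: "interpolates C S"
    using insert.IH determined_by_mono[OF insert.prems] by blast
  show ?case
  proof (cases "\<exists>c\<in>C. (\<forall>k\<in>S. c $ k = 0) \<and> c $ i \<notin> \<mm>")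
    case True
    then obtain c where c: "c \<in> C" "\<forall>k\<in>S. c $ k = 0" "c $ i \<notin> \<mm>" by blast
    obtain y where y: "c $ i * y = 1" using local_ring_unit[OF loc c(3)] .
    show ?thesis
      unfolding interpolates_def
    proof
      fix x
      obtain c0 where c0: "c0 \<in> C" "\<forall>k\<in>S. c0 $ k = x $ k"
        using IH unfolding interpolates_def by blast
      let ?c = "c0 + ((x $ i - c0 $ i) * y) *s c"
      have "?c \<in> C"
        using C c(1) c0(1) unfolding is_code_def by (intro free.subspace_add free.subspace_scale)
      moreover have "?c $ i = x $ i"
      proof -
        have "?c $ i = c0 $ i + (x $ i - c0 $ i) * (c $ i * y)" by (simp add: mult_ac)
        then show ?thesis using y by simp
      qed
      then have "\<forall>k\<in>insert i S. ?c $ k = x $ k" using c(2) c0(2) by simp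
      ultimately show "\<exists>c\<in>C. \<forall>k\<in>insert i S. c $ k = x $ k" by blast
    qed
  next
    case False
    obtain s where s: "s \<noteq> 0" "\<And>x. x \<in> \<mm> \<Longrightarrow> x * s = 0" using exists_socle_element[OF loc art] by blast
    obtain g where g: "\<And>c. c \<in> C \<Longrightarrow> c - (\<Sum>i\<in>S. c $ i *s g i) \<in> C"
      "\<And>c k. k \<in> S \<Longrightarrow> (c - (\<Sum>i\<in>S. c $ i *s g i)) $ k = 0"
      using interpolates_obtain_rows[OF C IH] by metis
    let ?u = "parity_check S g (axis i s)"
    have "scalar_product ?u c = 0" if "c \<in> C" for c
    proof -
      let ?r = "c - (\<Sum>i\<in>S. c $ i *s g i)"
      have "?r $ i \<in> \<mm>" using False g that by blast
      then have "s * ?r $ i = 0" using s(2) by (metis mult.commute)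
      then have "(\<Sum>j\<in>- S. axis i s $ j * ?r $ j) = 0"
        by (intro sum.neutral) (simp add: axis_def del: vector_minus_component)
      then show ?thesis by (simp only: scalar_product_parity_check)
    qed
    then have "?u \<in> dual_code C" by (simp add: dual_code_def)
    moreover have "\<forall>k\<in>- insert i S. ?u $ k = 0" by (simp add: parity_check_def axis_def)
    ultimately have "?u = 0" using insert.prems unfolding determined_by_def by blast
    moreover have "?u $ i = s" using insert.hyps by (simp add: parity_check_def)
    ultimately show ?thesis using s(1) by simp
  qed
qed

lemma information_set_dual_iff:
  fixes \<mm> :: "'a::comm_ring_1 set" and C :: "('a ^ 'n) set"
  assumes loc: "local_ring \<mm>" and art: "artinian_ring TYPE('a)" and C: "is_code C"
  shows "information_set (dual_code C) (- S) \<longleftrightarrow> information_set C S"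
proof
  assume "information_set (dual_code C) (- S)"
  then show "information_set C S"
    using interpolates_if_dual_determined[OF loc art C] code_determined_by_complement
    unfolding information_set_def by blast
next
  assume S: "information_set C S"
  then have "determined_by (dual_code C) (- S)"
    unfolding information_set_def by (blast intro: dual_determined_by_complement)
  then show "information_set (dual_code C) (- S)"
    using dual_interpolates_complement[OF C S] unfolding information_set_def by blast
qed

section \<open>Information sets of MDS codes\<close>

definition supported_in :: "'n set \<Rightarrow> ('a::comm_ring_1 ^ 'n) set" where
  "supported_in S = {v. \<forall>i. i \<notin> S \<longrightarrow> v $ i = 0}"

definition restriction :: "'n set \<Rightarrow> 'a::comm_ring_1 ^ 'n \<Rightarrow> 'a ^ 'n" where
  "restriction S v = (\<chi> i. if i \<in> S then v $ i else 0)"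

lemma subspace_supported_in: "free.subspace (supported_in S)"
  by (rule free.subspaceI) (simp_all add: supported_in_def)

lemma module_hom_restriction: "module_hom (*s) (*s) (restriction S)"
  by (intro module_hom.intro module_hom_axioms.intro module_vec)
    (simp_all add: restriction_def vec_eq_iff)

lemma module_hom_component: "module_hom (*s) (*) (\<lambda>v :: 'a::comm_ring_1 ^ 'n. v $ i)"
  by (intro module_hom.intro module_hom_axioms.intro module_vec module_self) simp_all

lemma length_supported_in:
  fixes S :: "'n::finite set"
  assumes "module_length (*) (UNIV :: 'a::comm_ring_1 set) = enat l"
  shows "module_length (*s) (supported_in S :: ('a ^ 'n) set) = enat (card S * l)"
  using finite[of S]
proof (induction S rule: finite_induct)
  case empty
  have "supported_in {} = {0 :: 'a ^ 'n}" by (auto simp: supported_in_def vec_eq_iff)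
  then show ?case by (simp add: zero_enat_def[symmetric])
next
  case (insert i S)
  interpret comp: module_hom "(*s)" "(*)" "\<lambda>v :: 'a ^ 'n. v $ i" by (rule module_hom_component)
  have "supported_in (insert i S) \<inter> {v. v $ i = 0} = (supported_in S :: ('a ^ 'n) set)"
    using insert.hyps by (auto simp: supported_in_def)
  moreover have "(\<lambda>v. v $ i) ` supported_in (insert i S) = (UNIV :: 'a set)"
  proof -
    have "a \<in> (\<lambda>v. v $ i) ` supported_in (insert i S)" for a :: 'a
      by (rule image_eqI[of _ _ "axis i a"]) (auto simp: supported_in_def axis_def)
    then show ?thesis by blast
  qed
  ultimately show ?case
    using comp.module_length_kernel_image[OF subspace_supported_in[of "insert i S"]] insert assms
    by simp
qed

text \<open>
  Restriction embeds \<open>C\<close> into the free module on \<open>S\<close>, whose proper submodules have smaller length.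
\<close>

lemma length_eq_iff_interpolates:
  fixes C :: "('a::comm_ring_1 ^ 'n) set"
  assumes l: "module_length (*) (UNIV :: 'a set) = enat l"
    and C: "is_code C" and det: "determined_by C S"
  shows "module_length (*s) C = enat (card S * l) \<longleftrightarrow> interpolates C S"
proof -
  interpret res: module_hom "(*s)" "(*s)" "restriction S :: 'a ^ 'n \<Rightarrow> 'a ^ 'n"
    by (rule module_hom_restriction)
  have sC: "free.subspace C" using C by (simp add: is_code_def)
  have "C \<inter> {v. restriction S v = 0} = {0}"
  proof -
    have "v = 0" if "v \<in> C" "restriction S v = 0" for v
    proof -
      have "\<forall>i\<in>S. v $ i = 0"
        using that(2) by (auto simp: restriction_def vec_eq_iff split: if_splits)
      then show ?thesis using det that(1) unfolding determined_by_def by blast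
    qed
    then show ?thesis using free.subspace_0[OF sC] by auto
  qed
  then have len: "module_length (*s) C = module_length (*s) (restriction S ` C)"
    using res.module_length_kernel_image[OF sC] by simp
  have sub: "restriction S ` C \<subseteq> supported_in S"
    by (auto simp: restriction_def supported_in_def)
  have "interpolates C S \<longleftrightarrow> restriction S ` C = supported_in S"
  proof
    assume S: "interpolates C S"
    have "x \<in> restriction S ` C" if x: "x \<in> supported_in S" for x
    proof -
      obtain c where "c \<in> C" "\<forall>i\<in>S. c $ i = x $ i" using S unfolding interpolates_def by blast
      then show ?thesis
        using x by (intro image_eqI[of _ _ c]) (auto simp: restriction_def supported_in_def vec_eq_iff)
    qed
    then show "restriction S ` C = supported_in S" using sub by blast
  next
    assume eq: "restriction S ` C = supported_in S"
    show "interpolates C S"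
      unfolding interpolates_def
    proof
      fix x :: "'a ^ 'n"
      have "restriction S x \<in> supported_in S" by (simp add: restriction_def supported_in_def)
      then obtain c where c: "c \<in> C" "restriction S x = restriction S c" using eq by blast
      have "c $ i = x $ i" if "i \<in> S" for i
        using arg_cong[OF c(2), of "\<lambda>v. v $ i"] that by (simp add: restriction_def)
      then show "\<exists>c\<in>C. \<forall>i\<in>S. c $ i = x $ i" using c(1) by blast
    qed
  qed
  also have "\<dots> \<longleftrightarrow> module_length (*s) (restriction S ` C) = module_length (*s) (supported_in S :: ('a ^ 'n) set)"
  proof
    assume eq: "module_length (*s) (restriction S ` C) = module_length (*s) (supported_in S :: ('a ^ 'n) set)"
    then have "module_length (*s) (restriction S ` C) \<noteq> \<infinity>"
      by (simp add: length_supported_in[OF l])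
    then show "restriction S ` C = supported_in S"
      using free.module_length_strict_mono[OF res.subspace_image[OF sC] subspace_supported_in] sub eq
      by (metis order_less_irrefl psubsetI)
  qed simp
  finally show ?thesis by (simp add: len length_supported_in[OF l])
qed

lemma hamming_weight_eq_0_iff: "hamming_weight v = 0 \<longleftrightarrow> v = 0"
  by (simp add: hamming_weight_def vec_eq_iff)

lemma finite_hamming_weights: "finite (hamming_weight ` (C :: ('a::zero ^ 'n) set))"
proof (rule finite_subset)
  show "hamming_weight ` C \<subseteq> {..CARD('n)}"
    by (auto simp: hamming_weight_def intro: card_mono)
qed simp

lemma min_distance_le:
  assumes "v \<in> C" "v \<noteq> 0"
  shows "min_distance C \<le> hamming_weight (v :: 'a::zero ^ 'n)"
  unfolding min_distance_def using assms by (intro Min_le finite_hamming_weights) auto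

lemma min_distance_attained:
  fixes C :: "('a::zero ^ 'n) set"
  assumes "w \<in> C" "w \<noteq> 0"
  obtains v where "v \<in> C" "v \<noteq> 0" "hamming_weight v = min_distance C"
proof -
  have "hamming_weight ` (C - {0}) \<noteq> {}" using assms by blast
  then have "min_distance C \<in> hamming_weight ` (C - {0})"
    unfolding min_distance_def by (rule Min_in[OF finite_hamming_weights])
  then obtain v where "v \<in> C - {0}" "min_distance C = hamming_weight v" by (rule imageE) simp
  then show ?thesis using that[of v] by simp
qed

lemma card_complement: "card (- S :: 'n::finite set) = CARD('n) - card S"
  by (simp add: Compl_eq_Diff_UNIV card_Diff_subset)

lemma hamming_weight_le_complement:
  fixes v :: "'a::zero ^ 'n"
  assumes "\<forall>i\<in>S. v $ i = 0"
  shows "hamming_weight v \<le> CARD('n) - card S"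
  unfolding hamming_weight_def card_complement[symmetric]
  using assms by (intro card_mono) auto

text \<open>
  If \<open>C\<close> is MDS with minimum distance \<open>d\<close>, then any \<open>k = n - d + 1\<close> coordinates determine a code word,
  since the zeros of a nonzero word number at most \<open>n - d\<close>; and the length \<open>k \<lambda>(R)\<close> of \<open>C\<close> forces
  the projection to any \<open>k\<close> coordinates to be onto. Conversely, if all \<open>k\<close>-element sets are information
  sets, a nonzero word has fewer than \<open>k\<close> zeros, and the word restricting to a unit vector on one of
  them has the least possible weight \<open>n - k + 1\<close>.
\<close>

lemma mds_code_iff_information_sets:
  fixes \<mm> :: "'a::comm_ring_1 set" and C :: "('a ^ 'n) set"
  assumes loc: "local_ring \<mm>" and art: "artinian_ring TYPE('a)"
    and C: "is_code C" and ne: "C \<noteq> {0}"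
  shows "mds_code C \<longleftrightarrow> (\<exists>k\<le>CARD('n). \<forall>S. card S = k \<longrightarrow> information_set C S)"
proof -
  obtain l where l: "module_length (*) (UNIV :: 'a set) = enat l"
    using local_artinian_length_finite[OF loc art] by auto
  have l0: "l > 0" using ring_length_pos[where 'a='a] l by (auto simp: zero_enat_def)
  have sC: "free.subspace C" using C by (simp add: is_code_def)
  have "C \<subseteq> supported_in UNIV" by (simp add: supported_in_def)
  then have "module_length (*s) C \<le> enat (CARD('n) * l)"
    using free.module_length_mono[OF sC subspace_supported_in] length_supported_in[OF l] by metis
  then obtain m where m: "module_length (*s) C = enat m" by (cases "module_length (*s) C") auto
  obtain w where w: "w \<in> C" "w \<noteq> 0" using ne free.subspace_0[OF sC] by blast
  let ?d = "min_distance C" and ?n = "CARD('n)"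
  obtain v where v: "v \<in> C" "v \<noteq> 0" "hamming_weight v = ?d" using min_distance_attained[OF w] .
  have d: "0 < ?d" "?d \<le> ?n"
    using hamming_weight_eq_0_iff[of v] hamming_weight_le_complement[of "{}" v] v by auto
  have mds: "mds_code C \<longleftrightarrow> real ?d = real ?n - real m / real l + 1"
    by (simp add: mds_code_def ne m l)
  show ?thesis
  proof
    assume "mds_code C"
    then have "real m = (real ?n + 1 - real ?d) * real l" using mds l0 by (simp add: field_simps)
    also have "\<dots> = real ((?n + 1 - ?d) * l)" using d by (simp add: of_nat_diff)
    finally have mk: "m = (?n + 1 - ?d) * l" by (simp only: of_nat_eq_iff)
    have "information_set C S" if S: "card S = ?n + 1 - ?d" for S
    proof -
      have "c = 0" if c: "c \<in> C" "\<forall>i\<in>S. c $ i = 0" for c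
      proof (rule ccontr)
        assume "c \<noteq> 0"
        then have "?d \<le> ?n - card S"
          using min_distance_le[OF c(1)] hamming_weight_le_complement[OF c(2)] by linarith
        then show False using S d by linarith
      qed
      then have "determined_by C S" unfolding determined_by_def by blast
      then show ?thesis
        using length_eq_iff_interpolates[OF l C, of S] m mk S unfolding information_set_def by simp
    qed
    moreover have "?n + 1 - ?d \<le> ?n" using d by simp
    ultimately show "\<exists>k\<le>?n. \<forall>S. card S = k \<longrightarrow> information_set C S" by blast
  next
    assume "\<exists>k\<le>?n. \<forall>S. card S = k \<longrightarrow> information_set C S"
    then obtain k where k: "k \<le> ?n" "\<And>S. card S = k \<Longrightarrow> information_set C S" by blast
    obtain S :: "'n set" where S: "card S = k"
      using obtain_subset_with_card_n[OF k(1)] by blast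
    have det: "determined_by C S" and int: "interpolates C S"
      using k(2)[OF S] by (simp_all add: information_set_def)
    have "S \<noteq> {}" using det w by (auto simp: determined_by_def)
    then obtain i where i: "i \<in> S" by blast
    then have k0: "k > 0" using S by (auto simp: card_gt_0_iff)
    have mk: "m = k * l" using length_eq_iff_interpolates[OF l C det] int m S by simp
    have lower: "?n - k + 1 \<le> ?d"
    proof (rule ccontr)
      assume "\<not> ?n - k + 1 \<le> ?d"
      then have "card {j. v $ j \<noteq> 0} \<le> ?n - k" using v(3) by (simp add: hamming_weight_def)
      moreover have "{j. v $ j = 0} = - {j. v $ j \<noteq> 0}" by blast
      ultimately have "k \<le> card {j. v $ j = 0}" using k(1) card_complement[of "{j. v $ j \<noteq> 0}"] by simp
      then obtain T where "T \<subseteq> {j. v $ j = 0}" "card T = k" using obtain_subset_with_card_n by blast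
      then show False using k(2)[of T] v unfolding information_set_def determined_by_def by blast
    qed
    obtain c where c: "c \<in> C" "\<forall>j\<in>S. c $ j = axis i 1 $ j"
      using int unfolding interpolates_def by blast
    have "c \<noteq> 0" using c(2) i by auto
    moreover have "hamming_weight c \<le> ?n - card (S - {i})"
      using c(2) by (intro hamming_weight_le_complement) (auto simp: axis_def)
    ultimately have "?d \<le> ?n - (k - 1)"
      using min_distance_le[OF c(1)] S i by (simp add: card_Diff_singleton)
    then have "?d = ?n - k + 1" using lower k0 k(1) by linarith
    then show "mds_code C" using mds mk l0 k(1) by (simp add: of_nat_diff)
  qed
qed

section \<open>Duality of MDS codes\<close>

theorem theorem3:
  fixes \<mm> :: "'a::comm_ring_1 set" and C :: "('a ^ 'n) set"
  assumes "local_ring \<mm>"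
    and "artinian_ring TYPE('a)"
    and "is_code C"
    and "C \<noteq> {0}"
    and "dual_code C \<noteq> {0}"
  shows "mds_code C \<longleftrightarrow> mds_code (dual_code C)"
proof -
  let ?n = "CARD('n)"
  note iff = information_set_dual_iff[OF assms(1-3)]
  have "(\<exists>k\<le>?n. \<forall>S. card S = k \<longrightarrow> information_set C S) \<longleftrightarrow>
    (\<exists>k\<le>?n. \<forall>S. card S = k \<longrightarrow> information_set (dual_code C) S)"
  proof
    assume "\<exists>k\<le>?n. \<forall>S. card S = k \<longrightarrow> information_set C S"
    then obtain k where k: "k \<le> ?n" "\<And>S. card S = k \<Longrightarrow> information_set C S" by blast
    have "information_set (dual_code C) S" if "card S = ?n - k" for S
      using iff[of "- S"] k(2)[of "- S"] card_complement[of S] that k(1) by simp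
    then show "\<exists>k\<le>?n. \<forall>S. card S = k \<longrightarrow> information_set (dual_code C) S"
      by (intro exI[of _ "?n - k"]) simp
  next
    assume "\<exists>k\<le>?n. \<forall>S. card S = k \<longrightarrow> information_set (dual_code C) S"
    then obtain k where k: "k \<le> ?n" "\<And>S. card S = k \<Longrightarrow> information_set (dual_code C) S" by blast
    have "information_set C S" if "card S = ?n - k" for S
      using iff[of S] k(2)[of "- S"] card_complement[of S] that k(1) by simp
    then show "\<exists>k\<le>?n. \<forall>S. card S = k \<longrightarrow> information_set C S"
      by (intro exI[of _ "?n - k"]) simp
  qed
  then show ?thesis
    using mds_code_iff_information_sets[OF assms(1,2,3,4)]
      mds_code_iff_information_sets[OF assms(1,2) dual_code_is_code assms(5)] by simp
qed

end
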